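(* Let $I$ be a bounded open interval, let $n$ be a positive integer, and let $f(x) \in C^{n}(I)$ and $u(x) \in C^{n}(I)$. Then in the interval $I$ it holds that $$f(x)\frac{d^n u(x)}{dx^n}=\sum_{k=0}^{n}(-1)^k\binom{n}{k}\frac{d^{n-k}}{dx^{n-k}}\left[\frac{d^kf(x)}{dx^k}\,u(x)\right].$$
   Context: Functions are real-valued, and $C^n(I)$ denotes the $n$ times continuously differentiable functions on the open interval $I$. The $0$th-order derivative of any $g \in C(I)$ is defined as the function itself: $\frac{d^0 g(x)}{dx^0} := g(x)$. *)

theory Defs
  imports "HOL-Analysis.Analysis"
begin

text \<open>
  The \<open>k\<close>-th derivative of \<open>f\<close> is \<open>(deriv ^^ k) f\<close>; for \<open>k = 0\<close> this is \<open>f\<close> itself.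
  Functions are total on the reals, but on an open set the iterated \<open>deriv\<close> depends only on the
  values of \<open>f\<close> in that set. Since \<open>deriv\<close> is also total (with an unspecified value where no
  derivative exists), existence of the derivatives is demanded explicitly.
\<close>

definition Cn_on :: "nat \<Rightarrow> (real \<Rightarrow> real) \<Rightarrow> real set \<Rightarrow> bool" where
  "Cn_on n f I \<longleftrightarrow>
     (\<forall>k<n. \<forall>x\<in>I. (deriv ^^ k) f field_differentiable at x) \<and>
     continuous_on I ((deriv ^^ n) f)"

end

theory Submission
  imports Defs
begin

text \<open>
  The formula is an inverted Leibniz rule: all derivatives are moved off \<open>u\<close> one at a time, by
  induction on \<open>n\<close> with \<open>f\<close> fixed and \<open>u\<close> arbitrary. Applying the formula of order \<open>n\<close> to \<open>u'\<close>
  expresses \<open>f * u\<^bsup>(n+1)\<^esup>\<close> through the derivatives of order \<open>n - k\<close> of \<open>f\<^bsup>(k)\<^esup> * u'\<close>. Each of these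
  products equals \<open>(f\<^bsup>(k)\<^esup> * u)' - f\<^bsup>(k+1)\<^esup> * u\<close> (lemma \<open>higher_deriv_Suc_mult\<close>), so every summand
  splits into a term with index \<open>k\<close> and one with index \<open>k + 1\<close> of the formula of order \<open>n + 1\<close>;
  Pascal's rule collects the coefficients.

  The outer derivative of order \<open>n - k\<close> may be distributed over the product rule only because
  both parts are \<open>n - k\<close> times differentiable, which is what the closure of \<open>n\<close>-fold
  differentiability under sums and products provides.
\<close>

definition times_differentiable_on ::
  "nat \<Rightarrow> ('a::real_normed_field \<Rightarrow> 'a) \<Rightarrow> 'a set \<Rightarrow> bool" where
  "times_differentiable_on n f S \<longleftrightarrow>
     (\<forall>k<n. \<forall>x\<in>S. (deriv ^^ k) f field_differentiable at x)"

lemma times_differentiable_on_0 [simp]: "times_differentiable_on 0 f S"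
  by (simp add: times_differentiable_on_def)

lemma times_differentiable_on_mono:
  "times_differentiable_on n f S \<Longrightarrow> m \<le> n \<Longrightarrow> times_differentiable_on m f S"
  by (simp add: times_differentiable_on_def)

lemma times_differentiable_on_Suc:
  "times_differentiable_on (Suc n) f S \<longleftrightarrow>
     (\<forall>x\<in>S. f field_differentiable at x) \<and> times_differentiable_on n (deriv f) S"
  by (auto simp: times_differentiable_on_def All_less_Suc2 funpow_Suc_right simp del: funpow.simps)

lemma times_differentiable_on_higher_deriv:
  "times_differentiable_on (n + k) f S \<Longrightarrow> times_differentiable_on n ((deriv ^^ k) f) S"
  by (induction k arbitrary: f)
    (simp_all add: times_differentiable_on_Suc funpow_Suc_right del: funpow.simps(2))

lemma higher_deriv_cong_open:
  assumes "open S" "\<And>x. x \<in> S \<Longrightarrow> f x = g x" "x \<in> S"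
  shows "(deriv ^^ n) f x = (deriv ^^ n) g x"
proof (rule higher_deriv_cong_ev[OF _ refl])
  show "eventually (\<lambda>y. f y = g y) (nhds x)"
    using eventually_nhds_in_open[OF assms(1,3)] by eventually_elim (rule assms(2))
qed

lemma times_differentiable_on_cong:
  assumes "open S" "\<And>x. x \<in> S \<Longrightarrow> f x = g x" "times_differentiable_on n f S"
  shows "times_differentiable_on n g S"
  unfolding times_differentiable_on_def
proof (intro allI impI ballI)
  fix k x assume "k < n" "x \<in> S"
  then obtain D where "((deriv ^^ k) f has_field_derivative D) (at x)"
    using assms(3) by (auto simp: times_differentiable_on_def field_differentiable_def)
  then have "((deriv ^^ k) g has_field_derivative D) (at x)"
    by (rule has_field_derivative_transform_within_open[OF _ assms(1) \<open>x \<in> S\<close>])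
      (rule higher_deriv_cong_open[OF assms(1,2)])
  then show "(deriv ^^ k) g field_differentiable at x"
    by (auto simp: field_differentiable_def)
qed

lemma times_differentiable_on_add:
  assumes "open S" "times_differentiable_on n f S" "times_differentiable_on n g S"
  shows "times_differentiable_on n (\<lambda>x. f x + g x) S"
  using assms(2,3)
proof (induction n arbitrary: f g)
  case (Suc n)
  then have "times_differentiable_on n (\<lambda>x. deriv f x + deriv g x) S"
    by (simp add: times_differentiable_on_Suc)
  then have "times_differentiable_on n (deriv (\<lambda>x. f x + g x)) S"
    by (rule times_differentiable_on_cong[OF assms(1), rotated])
      (use Suc.prems in \<open>auto simp: times_differentiable_on_Suc\<close>)
  then show ?case using Suc.prems
    by (auto simp: times_differentiable_on_Suc intro: field_differentiable_add)
qed simp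

lemma higher_deriv_add_open:
  assumes "open S" "times_differentiable_on n f S" "times_differentiable_on n g S" "x \<in> S"
  shows "(deriv ^^ n) (\<lambda>x. f x + g x) x = (deriv ^^ n) f x + (deriv ^^ n) g x"
  using assms(2,3)
proof (induction n arbitrary: f g)
  case (Suc n)
  have "(deriv ^^ Suc n) (\<lambda>x. f x + g x) x = (deriv ^^ n) (deriv (\<lambda>x. f x + g x)) x"
    by (simp add: funpow_Suc_right del: funpow.simps)
  also have "\<dots> = (deriv ^^ n) (\<lambda>x. deriv f x + deriv g x) x"
    using Suc.prems by (intro higher_deriv_cong_open[OF assms(1) _ assms(4)])
      (auto simp: times_differentiable_on_Suc)
  also have "\<dots> = (deriv ^^ n) (deriv f) x + (deriv ^^ n) (deriv g) x"
    using Suc by (simp add: times_differentiable_on_Suc)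
  finally show ?case by (simp add: funpow_Suc_right del: funpow.simps)
qed simp

lemma times_differentiable_on_mult:
  assumes "open S" "times_differentiable_on n f S" "times_differentiable_on n g S"
  shows "times_differentiable_on n (\<lambda>x. f x * g x) S"
  using assms(2,3)
proof (induction n arbitrary: f g)
  case (Suc n)
  have "times_differentiable_on n f S" "times_differentiable_on n g S"
    using Suc.prems times_differentiable_on_mono le_SucI by blast+
  then have "times_differentiable_on n (\<lambda>x. f x * deriv g x + deriv f x * g x) S"
    using Suc by (intro times_differentiable_on_add[OF assms(1)])
      (simp_all add: times_differentiable_on_Suc)
  then have "times_differentiable_on n (deriv (\<lambda>x. f x * g x)) S"
    by (rule times_differentiable_on_cong[OF assms(1), rotated])
      (use Suc.prems in \<open>auto simp: times_differentiable_on_Suc\<close>)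
  then show ?case using Suc.prems
    by (auto simp: times_differentiable_on_Suc intro: field_differentiable_mult)
qed simp

text \<open>
  The product rule under a further \<open>m\<close>-fold derivative. Read from right to left, it trades a
  derivative on \<open>g\<close> for one outside the product, at the cost of a term with a derivative on \<open>f\<close>.
\<close>

lemma higher_deriv_Suc_mult:
  assumes "open S" "times_differentiable_on (Suc m) f S" "times_differentiable_on (Suc m) g S"
    "x \<in> S"
  shows "(deriv ^^ Suc m) (\<lambda>y. f y * g y) x =
    (deriv ^^ m) (\<lambda>y. f y * deriv g y) x + (deriv ^^ m) (\<lambda>y. deriv f y * g y) x"
proof -
  have "times_differentiable_on m f S" "times_differentiable_on m g S"
    using assms(2,3) times_differentiable_on_mono le_SucI by blast+
  then have parts: "times_differentiable_on m (\<lambda>y. f y * deriv g y) S"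
      "times_differentiable_on m (\<lambda>y. deriv f y * g y) S"
    using assms(2,3) by (auto simp: times_differentiable_on_Suc
        intro: times_differentiable_on_mult[OF assms(1)])
  have "(deriv ^^ Suc m) (\<lambda>y. f y * g y) x = (deriv ^^ m) (deriv (\<lambda>y. f y * g y)) x"
    by (simp add: funpow_Suc_right del: funpow.simps)
  also have "\<dots> = (deriv ^^ m) (\<lambda>y. f y * deriv g y + deriv f y * g y) x"
    using assms(2,3) by (intro higher_deriv_cong_open[OF assms(1) _ assms(4)])
      (auto simp: times_differentiable_on_Suc)
  also have "\<dots> = (deriv ^^ m) (\<lambda>y. f y * deriv g y) x + (deriv ^^ m) (\<lambda>y. deriv f y * g y) x"
    by (rule higher_deriv_add_open[OF assms(1) parts assms(4)])
  finally show ?thesis .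
qed

text \<open>
  Pascal's rule for alternating binomial sums, in the form in which it closes the induction:
  a sum of consecutive differences with the coefficients of row \<open>n\<close> is a sum with those of row \<open>n + 1\<close>.
\<close>

lemma alternating_binomial_sum_Suc:
  fixes A :: "nat \<Rightarrow> 'a::comm_ring_1"
  shows "(\<Sum>k\<le>Suc n. (-1) ^ k * of_nat (Suc n choose k) * A k) =
    (\<Sum>k\<le>n. (-1) ^ k * of_nat (n choose k) * (A k - A (Suc k)))"
proof -
  have "(\<Sum>k\<le>Suc n. (-1) ^ k * of_nat (Suc n choose k) * A k) =
      A 0 + (\<Sum>k\<le>n. (-1) ^ Suc k * of_nat (n choose Suc k) * A (Suc k))
        - (\<Sum>k\<le>n. (-1) ^ k * of_nat (n choose k) * A (Suc k))"
    by (subst sum.atMost_Suc_shift) (simp add: algebra_simps sum.distrib sum_negf sum_subtractf)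
  \<comment> \<open>the summand with index \<open>n + 1\<close> that the shift introduces has coefficient \<open>n choose (n + 1) = 0\<close>\<close>
  also have "A 0 + (\<Sum>k\<le>n. (-1) ^ Suc k * of_nat (n choose Suc k) * A (Suc k)) =
      (\<Sum>k\<le>Suc n. (-1) ^ k * of_nat (n choose k) * A k)"
    by (subst sum.atMost_Suc_shift) simp
  also have "\<dots> = (\<Sum>k\<le>n. (-1) ^ k * of_nat (n choose k) * A k)"
    by (simp add: binomial_eq_0)
  finally show ?thesis
    by (simp add: right_diff_distrib sum_subtractf)
qed

text \<open>
  The induction replaces \<open>u\<close> by \<open>deriv u\<close> and keeps \<open>f\<close>. The orders balance: \<open>k\<close> derivatives spent
  on \<open>f\<close> leave it differentiable \<open>n - k\<close> more times, exactly as often as the product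
  \<open>(deriv ^^ k) f * u\<close> still has to be differentiated.
\<close>

lemma mult_higher_deriv_eq_alternating_sum:
  fixes f u :: "'a::real_normed_field \<Rightarrow> 'a"
  assumes "open S" "times_differentiable_on n f S" "times_differentiable_on n u S" "x \<in> S"
  shows "f x * (deriv ^^ n) u x =
    (\<Sum>k\<le>n. (-1) ^ k * of_nat (n choose k) *
      (deriv ^^ (n - k)) (\<lambda>y. (deriv ^^ k) f y * u y) x)"
  using assms(2,3)
proof (induction n arbitrary: u)
  case (Suc n)
  define A where "A k = (deriv ^^ (Suc n - k)) (\<lambda>y. (deriv ^^ k) f y * u y) x" for k
  have step: "(deriv ^^ (n - k)) (\<lambda>y. (deriv ^^ k) f y * deriv u y) x = A k - A (Suc k)"
    if "k \<le> n" for k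
  proof -
    have "times_differentiable_on (Suc (n - k)) ((deriv ^^ k) f) S"
      using Suc.prems(1) that by (intro times_differentiable_on_higher_deriv) simp
    moreover have "times_differentiable_on (Suc (n - k)) u S"
      using Suc.prems(2) by (rule times_differentiable_on_mono) simp
    ultimately show ?thesis
      using higher_deriv_Suc_mult[OF assms(1) _ _ assms(4)] that
      by (simp add: A_def Suc_diff_le del: funpow.simps) simp
  qed
  have "f x * (deriv ^^ Suc n) u x = f x * (deriv ^^ n) (deriv u) x"
    by (simp add: funpow_Suc_right del: funpow.simps)
  also have "\<dots> = (\<Sum>k\<le>n. (-1) ^ k * of_nat (n choose k) *
      (deriv ^^ (n - k)) (\<lambda>y. (deriv ^^ k) f y * deriv u y) x)"
    using Suc.prems times_differentiable_on_mono[OF Suc.prems(1), of n]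
    by (intro Suc.IH) (simp_all add: times_differentiable_on_Suc)
  also have "\<dots> = (\<Sum>k\<le>n. (-1) ^ k * of_nat (n choose k) * (A k - A (Suc k)))"
    by (intro sum.cong refl) (simp add: step)
  also have "\<dots> = (\<Sum>k\<le>Suc n. (-1) ^ k * of_nat (Suc n choose k) * A k)"
    by (rule alternating_binomial_sum_Suc[symmetric])
  finally show ?case by (simp only: A_def)
qed simp

theorem theorem1:
  fixes a b :: real and n :: nat and f u :: "real \<Rightarrow> real"
  assumes "a < b"
    and "n > 0"
    and "Cn_on n f {a<..<b}"
    and "Cn_on n u {a<..<b}"
  shows "\<forall>x\<in>{a<..<b}.
           f x * (deriv ^^ n) u x =
             (\<Sum>k=0..n. (-1) ^ k * real (n choose k) *
                (deriv ^^ (n - k)) (\<lambda>y. (deriv ^^ k) f y * u y) x)"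
proof
  fix x assume "x \<in> {a<..<b}"
  moreover have "times_differentiable_on n f {a<..<b}" "times_differentiable_on n u {a<..<b}"
    using assms(3,4) by (auto simp: Cn_on_def times_differentiable_on_def)
  ultimately show "f x * (deriv ^^ n) u x =
      (\<Sum>k=0..n. (-1) ^ k * real (n choose k) *
        (deriv ^^ (n - k)) (\<lambda>y. (deriv ^^ k) f y * u y) x)"
    unfolding atLeast0AtMost
    by (intro mult_higher_deriv_eq_alternating_sum[OF open_greaterThanLessThan])
qed

end
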